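(* Fix $k\ge 3$. Then, as $N\to\infty$, \[ f_k(N)\ll (\log N)^{\mu_k^{\mathrm S}-1+o(1)}; \] that is, for every $\varepsilon>0$ there is $C_\varepsilon>0$ such that $f_k(N)\le C_\varepsilon(\log N)^{\mu_k^{\mathrm S}-1+\varepsilon}$ for all sufficiently large $N$.
   Context: For integers $k\ge 3$ and $N\ge1$, a set $A\subseteq\{1,\dots,N\}$ is LCM-$k$-free if it does not contain distinct $a_1,\dots,a_k$ such that $\operatorname{lcm}(a_i,a_j)$ is the same for all $1\le i<j\le k$; $f_k(N):=\max\{\sum_{a\in A}1/a : A\subseteq\{1,\dots,N\}\text{ LCM-}k\text{-free}\}$. A collection of $k$ distinct sets $S_1,\dots,S_k$ is a $k$-sunflower if $S_i\cap S_j=S_1\cap S_2$ for all $1\le i<j\le k$; a family is $k$-sunflower-free if no $k$ distinct members form a $k$-sunflower. $F_k(n)$ is the maximum size of a $k$-sunflower-free family $\mathcal F\subseteq 2^{[n]}$, and $\mu_k^{\mathrm S}:=\limsup_{n\to\infty}F_k(n)^{1/n}$. *)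

theory Defs
  imports "HOL-Analysis.Analysis"
begin

definition lcm_free :: "nat \<Rightarrow> nat set \<Rightarrow> bool" where
  "lcm_free k A \<longleftrightarrow>
     \<not> (\<exists>a :: nat \<Rightarrow> nat. inj_on a {1..k} \<and> a ` {1..k} \<subseteq> A \<and>
          (\<exists>L. \<forall>i\<in>{1..k}. \<forall>j\<in>{1..k}. i < j \<longrightarrow> lcm (a i) (a j) = L))"

definition lcm_free_max :: "nat \<Rightarrow> nat \<Rightarrow> real" where
  "lcm_free_max k N = Max {\<Sum>a\<in>A. 1 / real a |A. A \<subseteq> {1..N} \<and> lcm_free k A}"

definition sunflower :: "nat \<Rightarrow> (nat \<Rightarrow> 'a set) \<Rightarrow> bool" where
  "sunflower k S \<longleftrightarrow> inj_on S {1..k} \<and>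
     (\<forall>i\<in>{1..k}. \<forall>j\<in>{1..k}. i < j \<longrightarrow> S i \<inter> S j = S 1 \<inter> S 2)"

definition sunflower_free :: "nat \<Rightarrow> 'a set set \<Rightarrow> bool" where
  "sunflower_free k \<F> \<longleftrightarrow> \<not> (\<exists>S. S ` {1..k} \<subseteq> \<F> \<and> sunflower k S)"

definition sunflower_free_max :: "nat \<Rightarrow> nat \<Rightarrow> nat" where
  "sunflower_free_max k n = Max {card \<F> |\<F>. \<F> \<subseteq> Pow {1..n} \<and> sunflower_free k \<F>}"

text \<open>The limit superior is taken in the extended reals, where it always exists; it is finite
  by \<open>ereal_sunflower_mu\<close> below, so the conversion to a real number loses nothing.\<close>

definition sunflower_mu :: "nat \<Rightarrow> real" where
  "sunflower_mu k =
     real_of_ereal (limsup (\<lambda>n. ereal (real (sunflower_free_max k n) powr (1 / real n))))"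

lemma lcm_free_empty: "k \<ge> 1 \<Longrightarrow> lcm_free k {}"
  by (auto simp: lcm_free_def)

lemma sunflower_free_empty: "k \<ge> 1 \<Longrightarrow> sunflower_free k {}"
  by (auto simp: sunflower_free_def)

lemma lcm_free_max_attained:
  assumes "k \<ge> 1"
  shows "\<exists>A \<subseteq> {1..N}. lcm_free k A \<and> lcm_free_max k N = (\<Sum>a\<in>A. 1 / real a)"
proof -
  let ?X = "{\<Sum>a\<in>A. 1 / real a |A. A \<subseteq> {1..N} \<and> lcm_free k A}"
  have "finite ?X"
    by (rule finite_subset[of _ "(\<lambda>A. \<Sum>a\<in>A. 1 / real a) ` Pow {1..N}"]) auto
  moreover have "?X \<noteq> {}" using lcm_free_empty[OF assms] by blast
  ultimately have "Max ?X \<in> ?X" by (rule Max_in)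
  thus ?thesis unfolding lcm_free_max_def by blast
qed

lemma sunflower_free_max_attained:
  assumes "k \<ge> 1"
  shows "\<exists>\<F> \<subseteq> Pow {1..n}. sunflower_free k \<F> \<and> sunflower_free_max k n = card \<F>"
proof -
  let ?X = "{card \<F> |\<F>. \<F> \<subseteq> Pow {1..n} \<and> sunflower_free k \<F>}"
  have "finite ?X"
    by (rule finite_subset[of _ "card ` Pow (Pow {1..n})"]) auto
  moreover have "?X \<noteq> {}" using sunflower_free_empty[OF assms] by blast
  ultimately have "Max ?X \<in> ?X" by (rule Max_in)
  thus ?thesis unfolding sunflower_free_max_def by blast
qed

lemma sunflower_free_max_le:
  assumes "k \<ge> 1"
  shows "sunflower_free_max k n \<le> 2 ^ n"
proof -
  obtain \<F> where \<F>: "\<F> \<subseteq> Pow {1..n}" "sunflower_free_max k n = card \<F>"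
    using sunflower_free_max_attained[OF assms, of n] by metis
  have "card \<F> \<le> card (Pow {1..n})"
    by (rule card_mono[OF _ \<F>(1)]) simp
  thus ?thesis using \<F>(2) by (simp add: card_Pow)
qed

lemma ereal_sunflower_mu:
  assumes "k \<ge> 1"
  shows "ereal (sunflower_mu k) =
     limsup (\<lambda>n. ereal (real (sunflower_free_max k n) powr (1 / real n)))"
proof -
  let ?f = "\<lambda>n. ereal (real (sunflower_free_max k n) powr (1 / real n))"
  have "?f n \<le> 2" if "n > 0" for n
  proof -
    have "real (sunflower_free_max k n) \<le> 2 ^ n"
      using sunflower_free_max_le[OF assms, of n] by (metis of_nat_le_iff of_nat_numeral of_nat_power)
    hence "real (sunflower_free_max k n) powr (1 / real n) \<le> (2 ^ n) powr (1 / real n)"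
      by (intro powr_mono2) auto
    also have "\<dots> = 2"
      using that powr_realpow[of 2 n] powr_powr[of 2 "real n" "1 / real n"] by simp
    finally show ?thesis by simp
  qed
  hence "limsup ?f \<le> 2"
    by (intro Limsup_bounded eventually_mono[OF eventually_gt_at_top[of 0]]) auto
  moreover have "limsup ?f \<ge> 0"
    by (intro le_Limsup) auto
  ultimately have "\<bar>limsup ?f\<bar> \<noteq> \<infinity>" by auto
  thus ?thesis unfolding sunflower_mu_def by (simp add: ereal_real)
qed

end

theory Submission
  imports Defs "HOL-Computational_Algebra.Squarefree"
begin

text \<open>
  A squarefree \<open>a\<close> is its set of prime factors, and least common multiples become unions, which are
  complements of intersections. Draw \<open>n\<close> primes independently with probabilities proportional to
  weights \<open>w p\<close> of total \<open>L\<close>, and count the sets of positions on which the sample is a bijection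
  onto a member of the family. These sets contain no \<open>k\<close> with equal pairwise unions, so there are at
  most \<open>F\<^sub>k(n)\<close> of them; taking expectations,
  \<open>\<Sum>\<^sub>a w(a) L ^ (n - |a|) / (n - |a|)! \<le> F\<^sub>k(n) L ^ n / n!\<close>. Summing over all \<open>n\<close> gives
  \<open>exp L \<cdot> \<Sum>\<^sub>a w(a) \<le> \<Sum>\<^sub>n F\<^sub>k(n) L ^ n / n! \<lless> exp ((\<mu> + \<epsilon>) L)\<close>.

  Rankin's trick replaces \<open>1/a\<close> by \<open>a powr -s\<close> with \<open>s = 1 + 1 / ln N\<close>; comparison with the zeta
  function then gives \<open>L = ln (ln N) + O(1)\<close> without Mertens' theorem. A general \<open>a\<close> is \<open>u v\<^sup>2\<close>
  with \<open>u\<close> squarefree; for fixed \<open>v\<close> the admissible \<open>u\<close> are again LCM-\<open>k\<close>-free, and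
  \<open>\<Sum>\<^sub>v 1 / v\<^sup>2\<close> converges.
\<close>

section \<open>Union-free families and their lifts along a map\<close>

text \<open>The complementary form of sunflower-freeness, stated without a ground set. The free
  common value \<open>U\<close> mirrors \<open>L\<close> in \<open>lcm_free\<close>, since least
  common multiples of products of primes become unions.\<close>

definition union_free :: "nat \<Rightarrow> 'a set set \<Rightarrow> bool" where
  "union_free k \<F> \<longleftrightarrow>
     \<not> (\<exists>S :: nat \<Rightarrow> 'a set. inj_on S {1..k} \<and> S ` {1..k} \<subseteq> \<F> \<and>
          (\<exists>U. \<forall>i\<in>{1..k}. \<forall>j\<in>{1..k}. i < j \<longrightarrow> S i \<union> S j = U))"

lemma union_freeD:
  assumes "union_free k \<F>" "inj_on S {1..k}" "S ` {1..k} \<subseteq> \<F>"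
    and "\<And>i j. i \<in> {1..k} \<Longrightarrow> j \<in> {1..k} \<Longrightarrow> i < j \<Longrightarrow> S i \<union> S j = U"
  shows False
proof -
  have "\<forall>i\<in>{1..k}. \<forall>j\<in>{1..k}. i < j \<longrightarrow> S i \<union> S j = U"
    using assms(4) by (intro ballI impI)
  then have "inj_on S {1..k} \<and> S ` {1..k} \<subseteq> \<F> \<and>
      (\<exists>U. \<forall>i\<in>{1..k}. \<forall>j\<in>{1..k}. i < j \<longrightarrow> S i \<union> S j = U)"
    using assms(2,3) by (intro conjI exI)
  then show False
    using assms(1) unfolding union_free_def by (elim notE) (rule exI)
qed

text \<open>Complementation in \<open>{1..n}\<close> is injective on \<open>\<F>\<close> and
  exchanges equal pairwise intersections with equal pairwise unions, so the complements form a
  sunflower-free family of the same size.\<close>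

lemma union_free_card_le:
  assumes "union_free k \<F>" "\<F> \<subseteq> Pow {1..n}"
  shows "card \<F> \<le> sunflower_free_max k n"
proof -
  let ?c = "\<lambda>T. {1..n} - T"
  have cc: "?c (?c T) = T" if "T \<in> \<F>" for T
    using that assms(2) by (intro double_diff) auto
  have inj: "inj_on ?c \<F>"
    using cc by (rule inj_on_inverseI)
  have "sunflower_free k (?c ` \<F>)"
    unfolding sunflower_free_def
  proof
    assume "\<exists>S. S ` {1..k} \<subseteq> ?c ` \<F> \<and> sunflower k S"
    then obtain S where S: "S ` {1..k} \<subseteq> ?c ` \<F>" "sunflower k S" by (elim exE conjE)
    have inter: "S i \<inter> S j = S 1 \<inter> S 2" if "i \<in> {1..k}" "j \<in> {1..k}" "i < j" for i j
      using S(2) that unfolding sunflower_def by blast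
    have sub: "S i \<subseteq> {1..n} \<and> ?c (S i) \<in> \<F>" if "i \<in> {1..k}" for i
    proof -
      obtain T where T: "T \<in> \<F>" "S i = ?c T" using S(1) \<open>i \<in> {1..k}\<close> by blast
      then show ?thesis using cc[OF T(1)] by auto
    qed
    have "inj_on (\<lambda>i. ?c (S i)) {1..k}"
    proof (rule inj_onI)
      fix i j assume ij: "i \<in> {1..k}" "j \<in> {1..k}" "?c (S i) = ?c (S j)"
      then have "S i = S j" using sub[of i] sub[of j] by blast
      then show "i = j" using S(2) ij unfolding sunflower_def by (blast dest: inj_onD)
    qed
    moreover have "(\<lambda>i. ?c (S i)) ` {1..k} \<subseteq> \<F>" using sub by blast
    moreover have "?c (S i) \<union> ?c (S j) = ?c (S 1 \<inter> S 2)"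
      if "i \<in> {1..k}" "j \<in> {1..k}" "i < j" for i j
      using inter[OF that] by blast
    ultimately show False by (rule union_freeD[OF assms(1)])
  qed
  moreover have "?c ` \<F> \<subseteq> Pow {1..n}" by blast
  moreover have "finite {card \<G> |\<G>. \<G> \<subseteq> Pow {1..n} \<and> sunflower_free k \<G>}"
    by (rule finite_subset[of _ "card ` Pow (Pow {1..n})"]) auto
  ultimately have "card (?c ` \<F>) \<le> sunflower_free_max k n"
    unfolding sunflower_free_max_def by (intro Max_ge) blast+
  then show ?thesis using card_image[OF inj] by simp
qed

text \<open>Distinct \<open>S i\<close>, \<open>S j\<close> have distinct images under \<open>g\<close>: if \<open>x \<in> S i - S j\<close> and \<open>y \<in> S j - S i\<close>
  had the same image, equality of the pairwise unions would put both \<open>x\<close> and \<open>y\<close> into every third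
  member \<open>S l\<close>, on which \<open>g\<close> is injective.\<close>
lemma union_free_lift:
  assumes "k \<ge> 3" "union_free k \<F>"
  shows "union_free k {T. T \<subseteq> I \<and> inj_on g T \<and> g ` T \<in> \<F>}"
  unfolding union_free_def
proof
  assume "\<exists>S. inj_on S {1..k} \<and> S ` {1..k} \<subseteq> {T. T \<subseteq> I \<and> inj_on g T \<and> g ` T \<in> \<F>} \<and>
    (\<exists>U. \<forall>i\<in>{1..k}. \<forall>j\<in>{1..k}. i < j \<longrightarrow> S i \<union> S j = U)"
  then obtain S U where "inj_on S {1..k}" "S ` {1..k} \<subseteq> {T. T \<subseteq> I \<and> inj_on g T \<and> g ` T \<in> \<F>}"
    and allU: "\<forall>i\<in>{1..k}. \<forall>j\<in>{1..k}. i < j \<longrightarrow> S i \<union> S j = U"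
    by (elim exE conjE)
  then have S: "inj_on S {1..k}" "\<And>i. i \<in> {1..k} \<Longrightarrow> inj_on g (S i) \<and> g ` S i \<in> \<F>"
    by blast+
  have U0: "\<And>i j. i \<in> {1..k} \<Longrightarrow> j \<in> {1..k} \<Longrightarrow> i < j \<Longrightarrow> S i \<union> S j = U"
    using allU by simp
  have U: "S i \<union> S j = U" if "i \<in> {1..k}" "j \<in> {1..k}" "i \<noteq> j" for i j
    using U0[of i j] U0[of j i] that by (cases "i < j") auto
  have sub: "S i \<subseteq> S j"
    if ij: "i \<in> {1..k}" "j \<in> {1..k}" "i \<noteq> j" "g ` S i = g ` S j" for i j
  proof
    fix x assume x: "x \<in> S i"
    then obtain y where y: "y \<in> S j" "g x = g y" using ij(4) by blast
    have "card {i, j} < card {1..k}" using assms(1) ij by auto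
    then have "{1..k} - {i, j} \<noteq> {}"
      using card_mono[of "{i, j}" "{1..k}"] by auto
    then obtain l where l: "l \<in> {1..k}" "l \<noteq> i" "l \<noteq> j" by blast
    show "x \<in> S j"
    proof (rule ccontr)
      assume nx: "x \<notin> S j"
      then have "y \<noteq> x" using y by blast
      then have "y \<notin> S i" using x y S(2)[OF ij(1)] by (auto dest: inj_onD)
      then have "x \<in> S l" "y \<in> S l"
        using U[of i l] U[of j l] U[of i j] nx x y l ij by blast+
      then show False using S(2)[OF l(1)] \<open>y \<noteq> x\<close> y by (auto dest: inj_onD)
    qed
  qed
  have "inj_on (\<lambda>i. g ` S i) {1..k}"
  proof (rule inj_onI)
    fix i j assume ij: "i \<in> {1..k}" "j \<in> {1..k}" "g ` S i = g ` S j"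
    show "i = j"
    proof (rule ccontr)
      assume "i \<noteq> j"
      then have "S i = S j" using sub[of i j] sub[of j i] ij by auto
      then show False using S(1) ij \<open>i \<noteq> j\<close> by (auto dest: inj_onD)
    qed
  qed
  moreover have "(\<lambda>i. g ` S i) ` {1..k} \<subseteq> \<F>" using S(2) by blast
  moreover have "g ` S i \<union> g ` S j = g ` U" if "i \<in> {1..k}" "j \<in> {1..k}" "i < j" for i j
    using U0[OF that] by (auto simp flip: image_Un)
  ultimately show False by (rule union_freeD[OF assms(2)])
qed

section \<open>Averaging over weighted samples\<close>

text \<open>Split by whether \<open>i \<in> T\<close>. If not, the new value is invisible; if so,
  \<open>y\<close> must lie in \<open>a\<close> and \<open>T - {i}\<close> must be mapped
  bijectively onto \<open>a - {y}\<close>. This drives the induction on \<open>I\<close>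
  below.\<close>

lemma card_bij_betw_subsets_insert:
  assumes "finite I" "i \<notin> I"
  shows "card {T. T \<subseteq> insert i I \<and> bij_betw (g(i := y)) T a} =
    card {T. T \<subseteq> I \<and> bij_betw g T a} +
    (if y \<in> a then card {T. T \<subseteq> I \<and> bij_betw g T (a - {y})} else 0)"
proof -
  define A where "A = {T. T \<subseteq> I \<and> bij_betw g T a}"
  define B where "B = (if y \<in> a then {T. T \<subseteq> I \<and> bij_betw g T (a - {y})} else {})"
  have same: "bij_betw (g(i := y)) T b \<longleftrightarrow> bij_betw g T b" if "T \<subseteq> I" for T b
    using that assms(2) by (intro bij_betw_cong) auto
  have ins: "bij_betw (g(i := y)) (insert i T) a \<longleftrightarrow> y \<in> a \<and> bij_betw g T (a - {y})"
    if "T \<subseteq> I" for T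
  proof -
    have "i \<notin> T" using that assms(2) by blast
    then have im: "g(i := y) ` T = g ` T" "inj_on (g(i := y)) T \<longleftrightarrow> inj_on g T"
      by (auto intro!: image_cong inj_on_cong)
    then show ?thesis
      using \<open>i \<notin> T\<close> by (auto simp: bij_betw_def)
  qed
  have "{T. T \<subseteq> insert i I \<and> bij_betw (g(i := y)) T a} = A \<union> insert i ` B"
  proof (intro set_eqI iffI)
    fix T assume T: "T \<in> {T. T \<subseteq> insert i I \<and> bij_betw (g(i := y)) T a}"
    show "T \<in> A \<union> insert i ` B"
    proof (cases "i \<in> T")
      case True
      then have T': "T = insert i (T - {i})" "T - {i} \<subseteq> I" using T by auto
      then have "T - {i} \<in> B" using ins[OF T'(2)] T by (auto simp: B_def)
      then show ?thesis using T'(1) by blast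
    next
      case False
      then have "T \<subseteq> I" using T by auto
      then show ?thesis using same[of T a] T by (auto simp: A_def)
    qed
  next
    fix T assume "T \<in> A \<union> insert i ` B"
    then show "T \<in> {T. T \<subseteq> insert i I \<and> bij_betw (g(i := y)) T a}"
      using same[of T a] ins by (auto simp: A_def B_def split: if_splits)
  qed
  moreover have "card (A \<union> insert i ` B) = card A + card (insert i ` B)"
    using assms by (intro card_Un_disjoint) (auto simp: A_def B_def)
  moreover have "card (insert i ` B) = card B"
    using assms(2) by (intro card_image inj_onI) (auto simp: B_def split: if_splits)
  ultimately show ?thesis by (simp add: A_def B_def)
qed

text \<open>With n = \<open>card I\<close> and r = \<open>card a\<close>, there are n! / (n - r)!
  ways to place the elements of \<open>a\<close> injectively at positions; they contribute
  \<open>prod w a\<close>, and each of the n - r free positions contributes \<open>sum w P\<close>.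
  This is an expectation left unnormalised, so the total weight may be 0.\<close>

lemma sum_PiE_card_bij_betw:
  fixes w :: "'a \<Rightarrow> real"
  assumes "finite I" "finite P" "a \<subseteq> P"
  shows "(\<Sum>g\<in>I \<rightarrow>\<^sub>E P. (\<Prod>i\<in>I. w (g i)) * real (card {T. T \<subseteq> I \<and> bij_betw g T a})) =
    (if card a \<le> card I then fact (card I) / fact (card I - card a) *
       (prod w a * sum w P ^ (card I - card a)) else 0)"
  using assms(1,3)
proof (induction I arbitrary: a rule: finite_induct)
  case empty
  have "finite a" using assms(2) empty by (rule rev_finite_subset)
  moreover have "{T. T \<subseteq> {} \<and> bij_betw g T a} = (if a = {} then {{}} else {})" for g :: "'b \<Rightarrow> 'a"
    by (auto simp: bij_betw_def)
  ultimately show ?case by simp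
next
  case (insert i I)
  let ?L = "sum w P" and ?n = "card I" and ?r = "card a"
  let ?c = "\<lambda>g a. real (card {T. T \<subseteq> I \<and> bij_betw g T a})"
  let ?W = "\<lambda>g. \<Prod>i\<in>I. w (g i)"
  let ?D = "\<lambda>a. \<Sum>g\<in>I \<rightarrow>\<^sub>E P. ?W g * ?c g a"
  have fa: "finite a" using assms(2) insert.prems by (rule rev_finite_subset)
  have W: "(\<Prod>j\<in>insert i I. w ((g(i := y)) j)) = w y * ?W g" for g y
  proof -
    have "(\<Prod>j\<in>I. w ((g(i := y)) j)) = ?W g"
      using insert.hyps by (intro prod.cong) auto
    then show ?thesis using insert.hyps by simp
  qed
  \<comment> \<open>A function on \<open>insert i I\<close> is its value \<open>y\<close> at
    \<open>i\<close> together with its restriction \<open>g\<close> to \<open>I\<close>.\<close>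
  have "(\<Sum>g\<in>insert i I \<rightarrow>\<^sub>E P. (\<Prod>i\<in>insert i I. w (g i)) *
      real (card {T. T \<subseteq> insert i I \<and> bij_betw g T a})) =
    (\<Sum>(y, g)\<in>P \<times> (I \<rightarrow>\<^sub>E P). w y * ?W g * (?c g a + (if y \<in> a then ?c g (a - {y}) else 0)))"
    unfolding PiE_insert_eq using insert.hyps
    by (subst sum.reindex[OF inj_combinator])
      (auto intro!: sum.cong simp: W card_bij_betw_subsets_insert simp del: prod.insert fun_upd_apply)
  also have "\<dots> = (\<Sum>y\<in>P. \<Sum>g\<in>I \<rightarrow>\<^sub>E P. w y * (?W g * ?c g a) +
      (if y \<in> a then w y * (?W g * ?c g (a - {y})) else 0))"
    by (subst sum.cartesian_product[symmetric]) (auto intro!: sum.cong simp: algebra_simps)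
  also have "\<dots> = (\<Sum>y\<in>P. w y * ?D a + (if y \<in> a then w y * ?D (a - {y}) else 0))"
    by (intro sum.cong refl) (auto simp: sum.distrib sum_distrib_left)
  also have "\<dots> = ?L * ?D a + (\<Sum>y\<in>a. w y * ?D (a - {y}))"
    using assms(2) insert.prems
    by (simp add: sum.distrib sum_distrib_right sum.If_cases Int_absorb1)
  finally have rec: "(\<Sum>g\<in>insert i I \<rightarrow>\<^sub>E P. (\<Prod>i\<in>insert i I. w (g i)) *
      real (card {T. T \<subseteq> insert i I \<and> bij_betw g T a})) =
    ?L * ?D a + (\<Sum>y\<in>a. w y * ?D (a - {y}))" .
  \<comment> \<open>Removing \<open>y\<close> lowers the cardinality by one and \<open>w y\<close>
    restores the product, so the term does not depend on \<open>y\<close> and the sum over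
    \<open>a\<close> is \<open>?r\<close> equal copies.\<close>
  have summand: "w y * ?D (a - {y}) = (if ?r \<le> Suc ?n then fact ?n / fact (Suc ?n - ?r) *
       (prod w a * ?L ^ (Suc ?n - ?r)) else 0)" if y: "y \<in> a" for y
  proof -
    have "?D (a - {y}) = (if card (a - {y}) \<le> ?n then fact ?n / fact (?n - card (a - {y})) *
       (prod w (a - {y}) * ?L ^ (?n - card (a - {y}))) else 0)"
      using insert.prems by (intro insert.IH) auto
    moreover have "?r = Suc (card (a - {y}))" using card_Suc_Diff1[OF fa y] by simp
    moreover have "prod w a = w y * prod w (a - {y})" using prod.remove[OF fa y] .
    ultimately show ?thesis by simp
  qed
  have IH: "?D a = (if ?r \<le> ?n then fact ?n / fact (?n - ?r) * (prod w a * ?L ^ (?n - ?r)) else 0)"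
    using insert.prems by (rule insert.IH)
  have "?L * ?D a + (\<Sum>y\<in>a. w y * ?D (a - {y})) = 
    (if ?r \<le> Suc ?n then fact (Suc ?n) / fact (Suc ?n - ?r) *
       (prod w a * ?L ^ (Suc ?n - ?r)) else 0)"
  proof -
    \<comment> \<open>In the first case the two contributions carry the factors m + 1 and r, which
      add up to n + 1 as n = r + m. In the second \<open>?D a\<close> vanishes and only the sum over
      \<open>y\<close> remains; in the third everything vanishes.\<close>
    consider "?r \<le> ?n" | "?r = Suc ?n" | "?r > Suc ?n" by linarith
    then show ?thesis
    proof cases
      case 1
      then obtain m where m: "?n = ?r + m" using le_Suc_ex by blast
      have e: "real ?n = real ?r + real m" using m by simp
      have "?L * ?D a = real (Suc m) * (fact ?n / fact (Suc m) * (prod w a * ?L ^ Suc m))"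
        unfolding IH fact_Suc using m by (simp del: of_nat_Suc)
      moreover have "(\<Sum>y\<in>a. w y * ?D (a - {y})) =
          real ?r * (fact ?n / fact (Suc m) * (prod w a * ?L ^ Suc m))"
        using summand 1 m by (simp add: Suc_diff_le del: fact_Suc)
      moreover have "fact (Suc ?n) / fact (Suc m) * (prod w a * ?L ^ Suc m) =
          (real (Suc m) + real ?r) * (fact ?n / fact (Suc m) * (prod w a * ?L ^ Suc m))"
        using m by (simp add: e algebra_simps)
      ultimately have "?L * ?D a + (\<Sum>y\<in>a. w y * ?D (a - {y})) =
          fact (Suc ?n) / fact (Suc m) * (prod w a * ?L ^ Suc m)"
        by (simp only: distrib_right)
      moreover have "?r \<le> Suc ?n" "Suc ?n - ?r = Suc m" using m by simp_all
      ultimately show ?thesis by (simp only: if_True)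
    next
      case 2
      then show ?thesis using summand IH by simp
    next
      case 3
      then have "(\<Sum>y\<in>a. w y * ?D (a - {y})) = (\<Sum>y\<in>a. 0)"
        using summand by (intro sum.cong) simp_all
      then show ?thesis using 3 IH by simp
    qed
  qed
  then show ?case using rec insert.hyps by simp
qed

text \<open>For each sample \<open>g\<close>, the position sets counted over all
  \<open>a \<in> \<F>\<close> make up the lifted family, which is union-free on
  \<open>{1..n}\<close>. Summing this pointwise bound against the weights and exchanging sums gives
  the inequality.\<close>

lemma weighted_union_free_le:
  fixes w :: "'a \<Rightarrow> real"
  assumes "k \<ge> 3" "union_free k \<F>" "finite P" "\<F> \<subseteq> Pow P" "\<And>p. p \<in> P \<Longrightarrow> w p \<ge> 0"
  shows "(\<Sum>a\<in>\<F>. if card a \<le> n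
      then prod w a * (sum w P ^ (n - card a) / fact (n - card a)) else 0) \<le>
    sunflower_free_max k n * (sum w P ^ n / fact n)"
proof -
  let ?I = "{1..n}" and ?L = "sum w P"
  let ?W = "\<lambda>g. \<Prod>i\<in>?I. w (g i)"
  have fF: "finite \<F>" using assms(3,4) by (meson finite_Pow_iff finite_subset)
  have "fact n * (\<Sum>a\<in>\<F>. if card a \<le> n
      then prod w a * (?L ^ (n - card a) / fact (n - card a)) else 0) =
    (\<Sum>a\<in>\<F>. \<Sum>g\<in>?I \<rightarrow>\<^sub>E P. ?W g * real (card {T. T \<subseteq> ?I \<and> bij_betw g T a}))"
    unfolding sum_distrib_left
  proof (intro sum.cong refl)
    fix a assume "a \<in> \<F>"
    then have "a \<subseteq> P" using assms(4) by blast
    then show "fact n * (if card a \<le> n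
      then prod w a * (?L ^ (n - card a) / fact (n - card a)) else 0) =
      (\<Sum>g\<in>?I \<rightarrow>\<^sub>E P. ?W g * real (card {T. T \<subseteq> ?I \<and> bij_betw g T a}))"
      using sum_PiE_card_bij_betw[of ?I P a w] assms(3) by simp
  qed
  also have "\<dots> = (\<Sum>g\<in>?I \<rightarrow>\<^sub>E P. ?W g * (\<Sum>a\<in>\<F>. real (card {T. T \<subseteq> ?I \<and> bij_betw g T a})))"
    unfolding sum_distrib_left by (rule sum.swap)
  also have "\<dots> \<le> (\<Sum>g\<in>?I \<rightarrow>\<^sub>E P. ?W g * sunflower_free_max k n)"
  proof (intro sum_mono mult_left_mono)
    fix g assume g: "g \<in> ?I \<rightarrow>\<^sub>E P"
    then show "?W g \<ge> 0" by (intro prod_nonneg ballI assms(5)) (rule PiE_mem)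
    \<comment> \<open>The image of \<open>T\<close> under \<open>g\<close> determines
      \<open>a\<close>, so the sets being counted are disjoint for different
      \<open>a\<close>.\<close>
    have "(\<Sum>a\<in>\<F>. card {T. T \<subseteq> ?I \<and> bij_betw g T a}) =
        card (\<Union>a\<in>\<F>. {T. T \<subseteq> ?I \<and> bij_betw g T a})"
      using fF by (intro card_UN_disjoint[symmetric]) (auto simp: bij_betw_def)
    also have "(\<Union>a\<in>\<F>. {T. T \<subseteq> ?I \<and> bij_betw g T a}) = {T. T \<subseteq> ?I \<and> inj_on g T \<and> g ` T \<in> \<F>}"
      by (auto simp: bij_betw_def)
    also have "card \<dots> \<le> sunflower_free_max k n"
      by (intro union_free_card_le union_free_lift assms) auto
    finally show "(\<Sum>a\<in>\<F>. real (card {T. T \<subseteq> ?I \<and> bij_betw g T a})) \<le> sunflower_free_max k n"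
      by (simp flip: of_nat_sum)
  qed
  also have "\<dots> = sunflower_free_max k n * (\<Sum>g\<in>?I \<rightarrow>\<^sub>E P. ?W g)"
    by (simp add: sum_distrib_left mult.commute)
  \<comment> \<open>The sampling identity at \<open>a = {}\<close>, where \<open>T = {}\<close> is
    the only position set, yields the total weight of all samples.\<close>
  also have "(\<Sum>g\<in>?I \<rightarrow>\<^sub>E P. ?W g) = ?L ^ n"
  proof -
    have "{T. T \<subseteq> ?I \<and> bij_betw g T {}} = {{}}" for g :: "nat \<Rightarrow> 'a"
      by (auto simp: bij_betw_def)
    then show ?thesis
      using sum_PiE_card_bij_betw[of ?I P "{}" w] assms(3) by simp
  qed
  finally show ?thesis by (simp add: field_simps)
qed

text \<open>Sum the preceding inequality over all \<open>n\<close>. For fixed \<open>a\<close> the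
  left side is the exponential series shifted by \<open>card a\<close>, hence
  \<open>prod w a * exp L\<close> with \<open>L = sum w P\<close>; the right side is at most
  \<open>C * exp (B * L)\<close>. Cancel \<open>exp L\<close>.\<close>

lemma weighted_union_free_exp_le:
  fixes w :: "'a \<Rightarrow> real"
  assumes "k \<ge> 3" "union_free k \<F>" "finite P" "\<F> \<subseteq> Pow P" "\<And>p. p \<in> P \<Longrightarrow> w p \<ge> 0"
    and F: "\<And>n. real (sunflower_free_max k n) \<le> C * B ^ n"
  shows "(\<Sum>a\<in>\<F>. prod w a) \<le> C * exp ((B - 1) * sum w P)"
proof -
  let ?L = "sum w P"
  have L: "?L \<ge> 0" using assms(5) by (rule sum_nonneg)
  have exp_sums: "(\<lambda>n. x ^ n / fact n) sums exp x" for x :: real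
    using exp_converges[of x] by (simp add: divide_inverse mult.commute)
  have "(\<lambda>n. if card a \<le> n then prod w a * (?L ^ (n - card a) / fact (n - card a)) else 0)
      sums (prod w a * exp ?L)" (is "?f sums _") for a
  proof -
    have "(\<lambda>n. ?f (n + card a)) sums (prod w a * exp ?L)"
      using sums_mult[OF exp_sums] by simp
    then show ?thesis by (subst (asm) sums_zero_iff_shift) auto
  qed
  then have "(\<lambda>n. \<Sum>a\<in>\<F>. if card a \<le> n
      then prod w a * (?L ^ (n - card a) / fact (n - card a)) else 0)
      sums (\<Sum>a\<in>\<F>. prod w a * exp ?L)"
    by (rule sums_sum)
  moreover have "(\<lambda>n. C * ((B * ?L) ^ n / fact n)) sums (C * exp (B * ?L))"
    by (intro sums_mult exp_sums)
  moreover have "(\<Sum>a\<in>\<F>. if card a \<le> n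
      then prod w a * (?L ^ (n - card a) / fact (n - card a)) else 0) \<le>
      C * ((B * ?L) ^ n / fact n)" for n
  proof -
    have "sunflower_free_max k n * (?L ^ n / fact n) \<le> (C * B ^ n) * (?L ^ n / fact n)"
      using F L by (intro mult_right_mono) auto
    then show ?thesis
      using weighted_union_free_le[OF assms(1-4), of w n] assms(5) by (simp add: power_mult_distrib)
  qed
  ultimately have "(\<Sum>a\<in>\<F>. prod w a * exp ?L) \<le> C * exp (B * ?L)"
    by (rule sums_le[rotated])
  then have "(\<Sum>a\<in>\<F>. prod w a) * exp ?L \<le> C * exp ((B - 1) * ?L) * exp ?L"
    by (simp add: sum_distrib_right algebra_simps flip: exp_add)
  then show ?thesis by simp
qed

section \<open>Exponential growth of \<open>sunflower_free_max\<close>\<close>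

lemma sunflower_free_max_le_power:
  assumes "k \<ge> 1" "B > sunflower_mu k"
  obtains C where "C > 0" "\<And>n. real (sunflower_free_max k n) \<le> C * B ^ n"
proof -
  let ?F = "\<lambda>n. real (sunflower_free_max k n)"
  let ?f = "\<lambda>n. ereal (?F n powr (1 / real n))"
  have lim: "limsup ?f < ereal B"
    using ereal_sunflower_mu[OF assms(1)] assms(2) by (metis less_ereal.simps(1))
  have "0 \<le> limsup ?f"
    by (intro le_Limsup) auto
  then have B: "B > 0" using lim by (metis ereal_less(2) le_less_trans)
  have "\<forall>\<^sub>F n in sequentially. ?f n < ereal B"
    using lim by (rule Limsup_lessD)
  then obtain M where M: "\<And>n. n \<ge> M \<Longrightarrow> ?F n powr (1 / real n) < B"
    unfolding eventually_sequentially by auto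
  \<comment> \<open>The sum dominates each ratio with \<open>n \<le> M\<close>, and the summand 1
    handles the larger \<open>n\<close>. The index 0, where the root \<open>1 / real n\<close> is
    degenerate, always falls into the first range.\<close>
  define C where "C = 1 + (\<Sum>n\<le>M. ?F n / B ^ n)"
  have Cge: "C \<ge> 1" unfolding C_def using B by (simp add: sum_nonneg)
  have "?F n \<le> C * B ^ n" for n
  proof (cases "n \<le> M")
    case True
    have "?F n / B ^ n \<le> (\<Sum>n\<le>M. ?F n / B ^ n)"
      using B True by (intro member_le_sum) auto
    then have "?F n / B ^ n \<le> C" unfolding C_def by linarith
    then show ?thesis using B by (simp add: field_simps)
  next
    case False
    then have n: "n > 0" "n \<ge> M" by auto
    have "?F n = (?F n powr (1 / real n)) ^ n"
      using n by (cases "?F n = 0") (simp_all add: powr_powr flip: powr_realpow)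
    also have "\<dots> \<le> B ^ n"
      using M[OF n(2)] by (intro power_mono) auto
    also have "\<dots> \<le> C * B ^ n" using Cge B by simp
    finally show ?thesis .
  qed
  then show ?thesis using that[of C] Cge by simp
qed

section \<open>Zeta sums, products of primes and the sum over primes\<close>

lemma sum_powr_le:
  fixes s :: real
  assumes "s > 1"
  shows "(\<Sum>n=1..M. real n powr - s) \<le> 1 + 1 / (s - 1)"
proof (cases M)
  case 0
  then show ?thesis using assms by simp
next
  case (Suc m)
  \<comment> \<open>The added fraction is the integral of \<open>x powr - s\<close> from 1 to
    \<open>Suc m\<close>; keeping its upper endpoint makes the induction telescope.\<close>
  have "(\<Sum>n=1..Suc m. real n powr - s) \<le> 1 + (1 - real (Suc m) powr (1 - s)) / (s - 1)"
  proof (induction m)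
    case 0
    then show ?case by simp
  next
    case (Suc m)
    let ?x = "real (Suc m)" and ?y = "real (Suc (Suc m))"
    \<comment> \<open>The mean value theorem for \<open>x powr (1 - s)\<close> replaces the
      comparison with an integral over one unit interval.\<close>
    have "\<exists>z>?x. z < ?y \<and> ?y powr (1 - s) - ?x powr (1 - s) =
        (?y - ?x) * ((1 - s) * z powr (- s))"
      using has_real_derivative_powr[of _ "1 - s"]
      by (intro MVT2[where f = "\<lambda>x. x powr (1 - s)"]) auto
    then obtain z where z: "z > ?x" "z < ?y"
      "?y powr (1 - s) - ?x powr (1 - s) = (1 - s) * z powr (- s)"
      by auto
    have "?y powr (- s) \<le> z powr (- s)"
      using z(1,2) assms by (intro powr_mono2') auto
    then have "(s - 1) * ?y powr (- s) \<le> (s - 1) * z powr (- s)"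
      using assms by simp
    also have "\<dots> = ?x powr (1 - s) - ?y powr (1 - s)"
      using z(3) by (simp add: algebra_simps)
    finally have "?y powr (- s) \<le> (?x powr (1 - s) - ?y powr (1 - s)) / (s - 1)"
      using assms by (simp add: field_simps)
    moreover have "(1 - ?y powr (1 - s)) / (s - 1) =
        (1 - ?x powr (1 - s)) / (s - 1) + (?x powr (1 - s) - ?y powr (1 - s)) / (s - 1)"
      by (simp flip: add_divide_distrib)
    moreover have "(\<Sum>n=1..Suc (Suc m). real n powr - s) =
        (\<Sum>n=1..Suc m. real n powr - s) + ?y powr (- s)"
      by simp
    ultimately show ?case using Suc.IH by linarith
  qed
  also have "\<dots> \<le> 1 + 1 / (s - 1)"
    using assms by (intro add_left_mono divide_right_mono) auto
  finally show ?thesis using Suc by simp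
qed

lemma prime_dvd_prod_primes_iff:
  fixes s :: "nat set"
  assumes "finite s" "\<And>p. p \<in> s \<Longrightarrow> prime p" "prime q"
  shows "q dvd \<Prod>s \<longleftrightarrow> q \<in> s"
proof -
  have "q dvd \<Prod>s \<longleftrightarrow> (\<exists>p\<in>s. q dvd p)" using assms by (intro prime_dvd_prod_iff)
  also have "\<dots> \<longleftrightarrow> q \<in> s" using assms(2,3) by (metis dvd_refl primes_dvd_imp_eq)
  finally show ?thesis .
qed

lemma inj_on_prod_primes:
  fixes P :: "nat set"
  assumes "finite P" "\<And>p. p \<in> P \<Longrightarrow> prime p"
  shows "inj_on \<Prod> (Pow P)"
proof (rule inj_onI)
  have sub: "s \<subseteq> t" if "s \<in> Pow P" "t \<in> Pow P" "\<Prod>s = \<Prod>t" for s t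
  proof
    fix p assume p: "p \<in> s"
    have fin: "finite s" "finite t" using that assms(1) by (auto intro: finite_subset)
    have "prime p" using p that assms(2) by auto
    then have "p dvd \<Prod>s"
      using p fin that assms(2) by (subst prime_dvd_prod_primes_iff) auto
    then have "p dvd \<Prod>t" using that by simp
    then show "p \<in> t"
      using \<open>prime p\<close> fin that assms(2) by (subst (asm) prime_dvd_prod_primes_iff) auto
  qed
  show "s = t" if "s \<in> Pow P" "t \<in> Pow P" "\<Prod>s = \<Prod>t" for s t
    using sub[OF that] sub[OF that(2,1)] that(3) by auto
qed

lemma lcm_prod_primes:
  fixes s t :: "nat set"
  assumes "finite s" "finite t" "\<And>p. p \<in> s \<union> t \<Longrightarrow> prime p"
  shows "lcm (\<Prod>s) (\<Prod>t) = \<Prod>(s \<union> t)"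
proof (rule dvd_antisym)
  show "lcm (\<Prod>s) (\<Prod>t) dvd \<Prod>(s \<union> t)"
    using assms by (intro lcm_least prod_dvd_prod_subset) auto
  \<comment> \<open>Passing to \<open>t - s\<close> makes the two factors coprime, so once each
    divides the lcm their product does too.\<close>
  have "\<Prod>(s \<union> t) = \<Prod>s * \<Prod>(t - s)"
    using assms by (subst prod.union_disjoint[symmetric]) (auto intro: prod.cong)
  moreover have "coprime (\<Prod>s) (\<Prod>(t - s))"
    using assms by (intro prod_coprime_left prod_coprime_right primes_coprime) auto
  moreover have "\<Prod>s dvd lcm (\<Prod>s) (\<Prod>t)" by simp
  moreover have "\<Prod>(t - s) dvd lcm (\<Prod>s) (\<Prod>t)"
    using assms by (intro dvd_lcmI2 prod_dvd_prod_subset) auto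
  ultimately show "\<Prod>(s \<union> t) dvd lcm (\<Prod>s) (\<Prod>t)"
    by (simp add: divides_mult)
qed

text \<open>Expanding \<open>\<Prod>(1 + p powr -s)\<close> gives distinct terms of the zeta series at \<open>s\<close>.\<close>
lemma sum_primes_powr_le:
  fixes s :: real
  assumes "s > 1"
  shows "(\<Sum>p | prime p \<and> p \<le> N. real p powr - s) \<le> ln (1 + 1 / (s - 1)) + 2"
proof -
  let ?P = "{p. prime p \<and> p \<le> N}"
  let ?w = "\<lambda>p. real p powr - s"
  have fP: "finite ?P" by simp
  have w1: "?w p \<le> 1" if "p \<in> ?P" for p
    using that assms prime_gt_0_nat[of p] powr_mono[of "- s" 0 "real p"] by auto
  have "(\<Prod>p\<in>?P. 1 + ?w p) = (\<Sum>t\<in>Pow ?P. prod ?w t)"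
    using prod_add[OF fP, of ?w "\<lambda>_. 1"] by (simp add: add.commute)
  also have "\<dots> = (\<Sum>t\<in>Pow ?P. real (\<Prod>t) powr - s)"
    by (simp add: prod_powr_distrib)
  also have "\<dots> = (\<Sum>n\<in>\<Prod> ` Pow ?P. real n powr - s)"
    by (subst sum.reindex[OF inj_on_prod_primes]) (auto simp: o_def)
  \<comment> \<open>Every subset product divides \<open>\<Prod>?P\<close>, so this is a sufficient
    cutoff.\<close>
  also have "\<dots> \<le> (\<Sum>n=1..\<Prod>?P. real n powr - s)"
  proof (rule sum_mono2)
    show "\<Prod> ` Pow ?P \<subseteq> {1..\<Prod>?P}"
    proof clarify
      fix t assume t: "t \<subseteq> ?P"
      then have "\<Prod>t dvd \<Prod>?P" by (intro prod_dvd_prod_subset fP)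
      moreover have "\<Prod>?P > 0" using prime_gt_0_nat by (intro prod_pos) auto
      moreover have "\<Prod>t > 0" using t prime_gt_0_nat by (intro prod_pos) auto
      ultimately show "\<Prod>t \<in> {1..\<Prod>?P}" using dvd_imp_le[of "\<Prod>t" "\<Prod>?P"] by auto
    qed
  qed auto
  also have "\<dots> \<le> 1 + 1 / (s - 1)" by (rule sum_powr_le[OF assms])
  finally have prod: "(\<Prod>p\<in>?P. 1 + ?w p) \<le> 1 + 1 / (s - 1)" .
  have pos: "1 + ?w p > 0" for p by (smt (verit) powr_ge_zero)
  \<comment> \<open>From x - x^2 \<le> ln (1 + x) on [0, 1]. The squares are at most
    \<open>p powr - 2\<close>, whose sum is at most 2; this is the constant in the
    statement.\<close>
  have "(\<Sum>p\<in>?P. ?w p) \<le> (\<Sum>p\<in>?P. ln (1 + ?w p) + real p powr - 2)"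
  proof (rule sum_mono)
    fix p assume p: "p \<in> ?P"
    have "?w p - (?w p)\<^sup>2 \<le> ln (1 + ?w p)"
      using w1[OF p] by (intro ln_one_plus_pos_lower_bound) auto
    moreover have "(?w p)\<^sup>2 \<le> real p powr - 2"
      using p assms prime_gt_0_nat[of p]
      by (auto simp: power2_eq_square simp flip: powr_add intro!: powr_mono)
    ultimately show "?w p \<le> ln (1 + ?w p) + real p powr - 2" by linarith
  qed
  also have "\<dots> = ln (\<Prod>p\<in>?P. 1 + ?w p) + (\<Sum>p\<in>?P. real p powr - 2)"
    using pos by (subst ln_prod) (auto simp: sum.distrib less_imp_neq[symmetric])
  also have "ln (\<Prod>p\<in>?P. 1 + ?w p) \<le> ln (1 + 1 / (s - 1))"
    using prod pos by (intro ln_mono prod_pos) auto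
  also have "(\<Sum>p\<in>?P. real p powr - 2) \<le> (\<Sum>n=1..N. real n powr - 2)"
    using prime_gt_0_nat by (intro sum_mono2) (auto simp: Suc_le_eq)
  also have "\<dots> \<le> 2" using sum_powr_le[of 2 N] by simp
  finally show ?thesis by simp
qed

section \<open>From LCM-free sets to union-free families\<close>

lemma squarefree_eq_prod_prime_factors:
  assumes "squarefree (n :: nat)"
  shows "n = \<Prod>(prime_factors n)"
proof -
  have n: "n \<noteq> 0" using assms not_squarefree_0 by metis
  have "n = (\<Prod>p\<in>prime_factors n. p ^ multiplicity p n)"
    using prod_prime_factors[OF n] by simp
  also have "\<dots> = \<Prod>(prime_factors n)"
    using assms n by (intro prod.cong) (auto simp: squarefree_factorial_semiring')
  finally show ?thesis .
qed

text \<open>A common factor \<open>v\<^sup>2\<close> comes out of every lcm, and products of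
  distinct primes turn unions into lcms. Equal pairwise unions would therefore give \<open>k\<close>
  distinct elements of \<open>A\<close> with equal pairwise lcms.\<close>

lemma lcm_free_imp_union_free:
  assumes "lcm_free k A" "v > 0" "finite P" "\<And>p. p \<in> P \<Longrightarrow> prime p"
  shows "union_free k {t \<in> Pow P. \<Prod>t * v\<^sup>2 \<in> A}"
  unfolding union_free_def
proof
  let ?F = "{t \<in> Pow P. \<Prod>t * v\<^sup>2 \<in> A}"
  assume "\<exists>S. inj_on S {1..k} \<and> S ` {1..k} \<subseteq> ?F \<and>
    (\<exists>U. \<forall>i\<in>{1..k}. \<forall>j\<in>{1..k}. i < j \<longrightarrow> S i \<union> S j = U)"
  then obtain S U where S: "inj_on S {1..k}" "S ` {1..k} \<subseteq> ?F"
    and U: "\<forall>i\<in>{1..k}. \<forall>j\<in>{1..k}. i < j \<longrightarrow> S i \<union> S j = U"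
    by (elim exE conjE)
  define a where "a = (\<lambda>i. \<Prod>(S i) * v\<^sup>2)"
  have sub: "S i \<subseteq> P" if "i \<in> {1..k}" for i using S(2) that by blast
  have "inj_on a {1..k}"
  proof (rule inj_onI)
    fix i j assume ij: "i \<in> {1..k}" "j \<in> {1..k}" "a i = a j"
    then have "\<Prod>(S i) = \<Prod>(S j)" using assms(2) by (simp add: a_def)
    then have "S i = S j"
      using inj_onD[OF inj_on_prod_primes[OF assms(3,4)]] sub ij by auto
    then show "i = j" using S(1) ij by (auto dest: inj_onD)
  qed
  moreover have "a ` {1..k} \<subseteq> A" using S(2) unfolding a_def by blast
  moreover have "\<forall>i\<in>{1..k}. \<forall>j\<in>{1..k}. i < j \<longrightarrow> lcm (a i) (a j) = \<Prod>U * v\<^sup>2"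
  proof (intro ballI impI)
    fix i j assume ij: "i \<in> {1..k}" "j \<in> {1..k}" "i < j"
    have "lcm (\<Prod>(S i)) (\<Prod>(S j)) = \<Prod>(S i \<union> S j)"
      using sub[OF ij(1)] sub[OF ij(2)] assms(3,4)
      by (intro lcm_prod_primes) (auto intro: finite_subset)
    then show "lcm (a i) (a j) = \<Prod>U * v\<^sup>2"
      using U ij by (simp add: a_def lcm_mult_right lcm.commute)
  qed
  ultimately have "\<exists>a. inj_on a {1..k} \<and> a ` {1..k} \<subseteq> A \<and>
     (\<exists>L. \<forall>i\<in>{1..k}. \<forall>j\<in>{1..k}. i < j \<longrightarrow> lcm (a i) (a j) = L)"
    by (intro exI conjI)
  then show False using assms(1) unfolding lcm_free_def by (rule notE[rotated])
qed

text \<open>The extra point \<open>0\<close>, which lies in no member of the family, carries the weight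
  needed to make the total weight exactly \<open>L\<close>.\<close>
lemma sum_squarefree_part_le:
  fixes s L :: real
  assumes k: "k \<ge> 3" and A: "lcm_free k A" and v: "v > 0"
    and F: "\<And>n. real (sunflower_free_max k n) \<le> C * B ^ n"
    and L: "(\<Sum>p | prime p \<and> p \<le> N. real p powr - s) \<le> L"
  shows "(\<Sum>t | t \<subseteq> {p. prime p \<and> p \<le> N} \<and> \<Prod>t * v\<^sup>2 \<in> A. real (\<Prod>t) powr - s)
    \<le> C * exp ((B - 1) * L)"
proof -
  let ?P = "{p. prime p \<and> p \<le> N}"
  let ?F = "{t \<in> Pow ?P. \<Prod>t * v\<^sup>2 \<in> A}"
  define w where "w p = (if p = 0 then L - (\<Sum>p\<in>?P. real p powr - s) else real p powr - s)"
    for p :: nat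
  have w: "w p = real p powr - s" if "p \<in> ?P" for p
    using that by (auto simp: w_def)
  have "sum w (insert 0 ?P) = w 0 + sum w ?P" by (subst sum.insert) auto
  also have "sum w ?P = (\<Sum>p\<in>?P. real p powr - s)" using w by (intro sum.cong) auto
  \<comment> \<open>An exact total is used because the sign of \<open>B - 1\<close> is not assumed:
    the exponential bound need not be monotone in the total weight.\<close>
  finally have sum: "sum w (insert 0 ?P) = L" by (simp add: w_def)
  have "(\<Sum>t\<in>?F. prod w t) \<le> C * exp ((B - 1) * sum w (insert 0 ?P))"
  proof (rule weighted_union_free_exp_le[OF k _ _ _ _ F])
    show "union_free k ?F" by (rule lcm_free_imp_union_free[OF A v]) auto
    show "?F \<subseteq> Pow (insert 0 ?P)" by auto
    show "w p \<ge> 0" for p using L by (auto simp: w_def)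
  qed simp
  moreover have "(\<Sum>t\<in>?F. prod w t) = (\<Sum>t\<in>?F. real (\<Prod>t) powr - s)"
  proof (intro sum.cong refl)
    fix t assume "t \<in> ?F"
    then have "prod w t = (\<Prod>p\<in>t. real p powr - s)" using w by (intro prod.cong) auto
    then show "prod w t = real (\<Prod>t) powr - s" by (simp add: prod_powr_distrib)
  qed
  ultimately show ?thesis using sum by simp
qed

text \<open>Group the elements of \<open>A\<close> by the square part \<open>v\<close> of a = u v^2.
  The sum over squarefree \<open>u\<close> has a bound independent of \<open>v\<close>, and as
  \<open>s \<ge> 1\<close> the outer weights are at most \<open>v powr - 2\<close>, which sum to at
  most 2.\<close>

lemma sum_lcm_free_powr_le:
  fixes s L :: real
  assumes k: "k \<ge> 3" and A: "lcm_free k A" "A \<subseteq> {1..N}" and s: "s \<ge> 1" and C: "C \<ge> 0"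
    and F: "\<And>n. real (sunflower_free_max k n) \<le> C * B ^ n"
    and L: "(\<Sum>p | prime p \<and> p \<le> N. real p powr - s) \<le> L"
  shows "(\<Sum>a\<in>A. real a powr - s) \<le> 2 * (C * exp ((B - 1) * L))"
proof -
  let ?P = "{p. prime p \<and> p \<le> N}"
  let ?F = "\<lambda>v. {t. t \<subseteq> ?P \<and> \<Prod>t * v\<^sup>2 \<in> A}"
  let ?f = "\<lambda>(v, t). \<Prod>t * v\<^sup>2"
  let ?S = "Sigma {1..N} ?F"
  have fF: "finite (?F v)" for v by (rule finite_subset[of _ "Pow ?P"]) auto
  have "A \<subseteq> ?f ` ?S"
  proof
    fix a assume a: "a \<in> A"
    define u v where "u = squarefree_part a" and "v = square_part a"
    have auv: "a = u * v\<^sup>2" unfolding u_def v_def by (rule squarefree_decompose)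
    have a0: "0 < a" "a \<le> N" using a A(2) by auto
    then have v0: "v > 0" "u > 0" using auv by (auto intro!: Nat.gr0I)
    have "u dvd a" "v dvd a" using auv by (auto simp: power2_eq_square)
    then have le: "u \<le> N" "v \<le> N" using a0 by (auto dest!: dvd_imp_le)
    have u: "u = \<Prod>(prime_factors u)"
      by (rule squarefree_eq_prod_prime_factors) (simp add: u_def)
    moreover have "prime_factors u \<subseteq> ?P"
      using v0 le by (auto dest!: dvd_imp_le simp: prime_factors_dvd)
    ultimately have "(v, prime_factors u) \<in> ?S" using a auv v0 le by auto
    moreover have "a = ?f (v, prime_factors u)" using auv u by simp
    ultimately show "a \<in> ?f ` ?S" by blast
  qed
  then have "(\<Sum>a\<in>A. real a powr - s) \<le> (\<Sum>a\<in>?f ` ?S. real a powr - s)"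
    using fF by (intro sum_mono2) auto
  \<comment> \<open>Since the terms are nonnegative, it is enough that the pairs
    \<open>(v, t)\<close> cover \<open>A\<close>.\<close>
  also have "\<dots> \<le> (\<Sum>x\<in>?S. real (?f x) powr - s)"
    using fF by (intro sum_image_le[of ?S "\<lambda>a. real a powr - s" ?f, unfolded o_def]) auto
  also have "\<dots> = (\<Sum>v=1..N. \<Sum>t\<in>?F v. real (\<Prod>t * v\<^sup>2) powr - s)"
    using fF by (subst sum.Sigma) (auto intro!: sum.cong)
  also have "\<dots> = (\<Sum>v=1..N. real (v\<^sup>2) powr - s * (\<Sum>t\<in>?F v. real (\<Prod>t) powr - s))"
    by (simp add: powr_mult sum_distrib_left mult.commute)
  also have "\<dots> \<le> (\<Sum>v=1..N. real v powr - 2 * (C * exp ((B - 1) * L)))"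
  proof (intro sum_mono mult_mono)
    fix v assume v: "v \<in> {1..N}"
    have "real (v\<^sup>2) powr - s \<le> real (v\<^sup>2) powr - 1"
      using v s by (intro powr_mono) auto
    also have "\<dots> = real v powr - 2"
      using v by (simp add: powr_minus powr_realpow)
    finally show "real (v\<^sup>2) powr - s \<le> real v powr - 2" .
    show "(\<Sum>t\<in>?F v. real (\<Prod>t) powr - s) \<le> C * exp ((B - 1) * L)"
      using v by (intro sum_squarefree_part_le[OF k A(1) _ F L]) auto
  qed (auto intro: sum_nonneg)
  also have "\<dots> = (\<Sum>v=1..N. real v powr - 2) * (C * exp ((B - 1) * L))"
    by (simp add: sum_distrib_right)
  also have "\<dots> \<le> 2 * (C * exp ((B - 1) * L))"
    using sum_powr_le[of 2 N] C by (intro mult_right_mono) auto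
  finally show ?thesis .
qed

section \<open>Rankin's trick and the final bound\<close>

theorem theorem1p5:
  fixes k :: nat
  assumes "k \<ge> 3"
  shows "\<forall>\<epsilon>::real. \<epsilon> > 0 \<longrightarrow>
           (\<exists>C::real. C > 0 \<and>
             (\<forall>\<^sub>F N in sequentially.
                lcm_free_max k N \<le> C * ln (real N) powr (sunflower_mu k - 1 + \<epsilon>)))"
proof (intro allI impI)
  fix \<epsilon> :: real assume \<epsilon>: "\<epsilon> > 0"
  define B where "B = sunflower_mu k + \<epsilon>"
  obtain C where C: "C > 0" "\<And>n. real (sunflower_free_max k n) \<le> C * B ^ n"
    using sunflower_free_max_le_power[of k B] assms \<epsilon> by (auto simp: B_def)
  \<comment> \<open>The 2 comes from the sum over primes and \<open>ln 2\<close> from 1 + l \<le> 2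
    l. In \<open>K\<close>, the factor \<open>exp 1\<close> is the cost of Rankin's trick and the
    factor 2 that of the sum over square parts.\<close>
  define c where "c = ln 2 + (2 :: real)"
  define K where "K = exp 1 * (2 * (C * exp ((B - 1) * c)))"
  \<comment> \<open>\<open>N \<ge> 3\<close> exceeds e, so \<open>ln N \<ge> 1\<close>.\<close>
  have "lcm_free_max k N \<le> K * ln (real N) powr (B - 1)" if N: "N \<ge> 3" for N
  proof -
    obtain A where A: "A \<subseteq> {1..N}" "lcm_free k A" "lcm_free_max k N = (\<Sum>a\<in>A. 1 / real a)"
      using lcm_free_max_attained[of k N] assms by auto
    define l where "l = ln (real N)"
    have "exp 1 \<le> real N" using N exp_le by linarith
    then have l: "l \<ge> 1" unfolding l_def using N by (subst ln_ge_iff) auto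
    \<comment> \<open>With this exponent \<open>1 / (s - 1)\<close> is exactly \<open>l\<close>, so
      the sum over primes is at most \<open>ln l + c\<close>.\<close>
    define s where "s = 1 + 1 / l"
    have s: "s > 1" using l by (simp add: s_def)
    have "(\<Sum>p | prime p \<and> p \<le> N. real p powr - s) \<le> ln (1 + 1 / (s - 1)) + 2"
      by (rule sum_primes_powr_le[OF s])
    also have "1 + 1 / (s - 1) = 1 + l" by (simp add: s_def)
    also have "ln (1 + l) \<le> ln (2 * l)" using l by (intro ln_mono) auto
    also have "ln (2 * l) + 2 = ln l + c" using l by (simp add: ln_mult c_def)
    finally have L: "(\<Sum>p | prime p \<and> p \<le> N. real p powr - s) \<le> ln l + c" by simp
    \<comment> \<open>Rankin's trick: \<open>a powr (s - 1) \<le> e\<close> on \<open>{1..N}\<close>.\<close>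
    have "(\<Sum>a\<in>A. 1 / real a) \<le> (\<Sum>a\<in>A. exp 1 * real a powr - s)"
    proof (rule sum_mono)
      fix a assume "a \<in> A"
      then have a: "1 \<le> real a" "real a \<le> real N" using A(1) by auto
      have "real a powr (1 / l) \<le> real N powr (1 / l)"
        using a l by (intro powr_mono2) auto
      also have "\<dots> = exp 1" using N l by (simp add: powr_def l_def)
      finally have "real a powr (1 / l) * real a powr - s \<le> exp 1 * real a powr - s"
        by (intro mult_right_mono) auto
      moreover have "real a powr (1 / l) * real a powr - s = 1 / real a"
        using a by (simp add: s_def powr_minus_divide flip: powr_add)
      ultimately show "1 / real a \<le> exp 1 * real a powr - s" by simp
    qed
    also have "\<dots> = exp 1 * (\<Sum>a\<in>A. real a powr - s)" by (simp add: sum_distrib_left)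
    also have "\<dots> \<le> exp 1 * (2 * (C * exp ((B - 1) * (ln l + c))))"
      using C s by (intro mult_left_mono sum_lcm_free_powr_le[OF assms A(2,1) _ _ C(2) L]) auto
    \<comment> \<open>\<open>exp ((B - 1) * ln l)\<close> is \<open>l powr (B - 1)\<close>; the part
      with \<open>c\<close> is absorbed in \<open>K\<close>.\<close>
    also have "\<dots> = K * l powr (B - 1)"
      using l by (simp add: K_def powr_def distrib_left exp_add)
    finally show ?thesis using A(3) by (simp add: l_def)
  qed
  then have "\<forall>\<^sub>F N in sequentially. lcm_free_max k N \<le> K * ln (real N) powr (B - 1)"
    unfolding eventually_sequentially by blast
  moreover have "K > 0" using C(1) by (simp add: K_def)
  moreover have "B - 1 = sunflower_mu k - 1 + \<epsilon>" by (simp add: B_def)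
  ultimately show "\<exists>C>0. \<forall>\<^sub>F N in sequentially.
      lcm_free_max k N \<le> C * ln (real N) powr (sunflower_mu k - 1 + \<epsilon>)"
    by auto
qed

end
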